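(* For any $u,v$, set $z=u/v$. For the $U_q(\widehat{\mathfrak{sl}}(V))$-modules $\varrho^{a,b}_u,\varrho^{a,b}_v$ (the evaluation modules, with $ab=(-1)^{\bar N}$), let $$R(z)=(z-1)\Big\{\mathrm I+(q^{1/2}-q^{-1/2})\sum_{i=1}^N(-1)^{\bar i}q^{(\varepsilon_i,\varepsilon_i)/2}E_{ii}\otimes E_{ii}+(q-q^{-1})\sum_{i>j}(-1)^{\bar j}E_{ij}\otimes E_{ji}\Big\}+(q-q^{-1})\tau.$$ Then the operator $\hat R(z)=\tau\circ R(z)$ satisfies $$\hat R(u/v)\circ(\varrho^{a,b}_u\otimes\varrho^{a,b}_v)(x)=(\varrho^{a,b}_v\otimes\varrho^{a,b}_u)(x)\circ\hat R(u/v)\qquad\text{for all }x\in U_q(\widehat{\mathfrak{sl}}(V)).$$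
   Context: **Setup.** Fix integers $m,n\ge0$ with $N=m+n>2$, and let $K=\mathbb C(q^{1/2})$. $V=\mathbb C^{m|n}$ (with scalars extended to $K$) is a superspace with homogeneous basis $v_1,\dots,v_N$, $m$ of them even and $n$ odd, of parities $\bar i\in\{0,1\}$ in any order. $E_{ij}$ are the matrix units, of parity $\bar i+\bar j$; $\mathrm I$ is the identity. Tensor products are graded: $(x\otimes y)(x'\otimes y')=(-1)^{|y||x'|}xx'\otimes yy'$, $(X\otimes Y)(v\otimes w)=(-1)^{|Y||v|}Xv\otimes Yw$; $\tau(v_i\otimes v_j)=(-1)^{\bar i\,\bar j}v_j\otimes v_i$. $\varepsilon_1,\dots,\varepsilon_N$ are linearly independent with $(\varepsilon_i,\varepsilon_j)=\delta_{ij}(-1)^{\bar i}$; $\alpha_i=\varepsilon_i-\varepsilon_{i+1}$ for $1\le i<N$; $\theta=\varepsilon_1-\varepsilon_N=\alpha_1+\dots+\alpha_{N-1}$; $\alpha_0=\delta-\theta$ with $(\delta,\delta)=(\delta,\varepsilon_i)=0$, and $\alpha_0$ has the same parity as $\theta$ (the parity of $\varepsilon_i-\varepsilon_j$ is $\bar i+\bar j$); $a_{ij}=(\alpha_i,\alpha_j)$ for $0\le i,j<N$. **Algebra.** $U_q(\widehat{\mathfrak{sl}}(V))$ is the $K$-superalgebra generated by $e_i,f_i,q^{\pm h_i/2}$ ($0\le i<N$), $\gamma^{\pm1},D^{\pm1}$, with $|e_i|=|f_i|$ the parity of $\alpha_i$ and the other generators even, subject to: $D^{\pm1}D^{\mp1}=1$,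 $[D,q^{h_i/2}]=0$, $De_iD^{-1}=q^{\delta_{0i}}e_i$, $Df_iD^{-1}=q^{-\delta_{0i}}f_i$; $\gamma^{\pm1}\gamma^{\mp1}=1$, $\gamma=q^{h_0/2}q^{h_1/2}\cdots q^{h_{N-1}/2}$ central; $[q^{h_i/2},q^{h_j/2}]=0$, $q^{\pm h_i/2}q^{\mp h_i/2}=1$, $q^{h_i/2}e_jq^{-h_i/2}=q^{a_{ij}/2}e_j$, $q^{h_i/2}f_jq^{-h_i/2}=q^{-a_{ij}/2}f_j$, $e_if_j-(-1)^{|e_i||f_j|}f_je_i=\delta_{ij}\frac{q^{h_i}-q^{-h_i}}{q-q^{-1}}$; and the following $q$-Serre relations, where indices $i\pm1$ are understood modulo $N$ and $[\![a,b]\!]=ab-(-1)^{|a||b|}q^{(\deg a,\deg b)}ba$ with $\deg e_i=\alpha_i$, $\deg f_i=-\alpha_i$: (1) $[\![e_i,e_j]\!]=0$ if $a_{ij}=0$; (2) $[\![e_i,[\![e_i,e_j]\!]]\!]=0$ if $j=i\pm1$ and $\alpha_i$ is even; (3) $[\![[\![[\![e_{i-1},e_i]\!],e_{i+1}]\!],e_i]\!]=0$ if $\alpha_i$ is odd; (4) in addition, if $mn=2$, $[\![e_j,[\![e_k,[\![e_j,[\![e_k,e_i]\!]]\!]]\!]]\!]=[\![e_k,[\![e_j,[\![e_k,[\![e_j,e_i]\!]]\!]]\!]]\!]$ for $\{i,j,k\}=\{0,1,2\}$ with $\alpha_i$ even and $\alpha_j,\alpha_k$ odd; and the same relations with the $e$'s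 replaced by $f$'s. Coproduct: $\Delta(e_i)=q^{h_i/2}\otimes e_i+e_i\otimes q^{-h_i/2}$, $\Delta(f_i)=q^{h_i/2}\otimes f_i+f_i\otimes q^{-h_i/2}$, and $q^{\pm h_i/2},\gamma^{\pm1},D^{\pm1}$ are group-like. **Evaluation modules.** For an indeterminate $u$ and $a,b\in\mathbb C^\times$ with $ab=(-1)^{\bar N}$, $V(u)=V\otimes_{\mathbb C}\mathbb C[u,u^{-1}]$ carries the action $\varrho^{a,b}_u$: $e_i\mapsto E_{i,i+1}$, $f_i\mapsto(-1)^{\bar i}E_{i+1,i}$, $q^{\pm h_i/2}\mapsto q^{\pm((-1)^{\bar i}E_{ii}-(-1)^{\overline{i+1}}E_{i+1,i+1})/2}$ for $1\le i<N$; $e_0\mapsto au\,E_{N1}$, $f_0\mapsto bu^{-1}E_{1N}$, $q^{\pm h_0/2}\mapsto q^{\mp((-1)^{\bar1}E_{11}-(-1)^{\bar N}E_{NN})/2}$, $\gamma^{\pm1}\mapsto\mathrm I$, $D^{\pm1}(v\otimes u^k)=q^{\pm k}v\otimes u^k$. (For a diagonal matrix $A=\mathrm{diag}(d_1,\dots,d_N)$, $q^A=\mathrm{diag}(q^{d_1},\dots,q^{d_N})$.) **Meaning of the identity.** $(\varrho^{a,b}_u\otimes\varrho^{a,b}_v)(x)$ is the action of $\Delta(x)$ on $V(u)\otimes V(v)$. Equivalently, the identity may be required for all $x$ in the version of the algebra without the generators $D^{\pm1}$, with the evaluation modules regarded as modules over it. *)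

theory Defs
  imports
    "HOL-Library.Poly_Mapping"
    "HOL-Computational_Algebra.Polynomial"
    "HOL-Computational_Algebra.Fraction_Field"
    "HOL-Algebra.QuotRing"
begin

section \<open>Scalars and formal linear combinations\<close>

text \<open>The field of rational functions over the complex numbers in the variable \<open>q\<^sup>1\<^sup>/\<^sup>2\<close>,
  which is called \<open>qh\<close>; so \<open>q = qh\<^sup>2\<close> and \<open>q\<^sup>d\<^sup>/\<^sup>2 = qh powi d\<close>.\<close>

type_synonym Kq = "complex poly fract"

definition of_C :: "complex \<Rightarrow> Kq" where
  "of_C c = Fraction_Field.Fract [:c:] 1"

definition qh :: Kq where
  "qh = Fraction_Field.Fract [:0, 1:] 1"

definition q :: Kq where
  "q = qh ^ 2"

text \<open>The vector space with basis \<open>'b\<close> is \<open>'b \<Rightarrow>\<^sub>0 Kq\<close>, with \<open>single b 1\<close> the basis vector of \<open>b\<close>.\<close>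

abbreviation sgl :: "'b \<Rightarrow> Kq \<Rightarrow> 'b \<Rightarrow>\<^sub>0 Kq" where
  "sgl \<equiv> Poly_Mapping.single"

abbreviation keys :: "('b \<Rightarrow>\<^sub>0 Kq) \<Rightarrow> 'b set" where
  "keys \<equiv> Poly_Mapping.keys"

abbreviation lookup :: "('b \<Rightarrow>\<^sub>0 Kq) \<Rightarrow> 'b \<Rightarrow> Kq" where
  "lookup \<equiv> Poly_Mapping.lookup"

definition smul :: "Kq \<Rightarrow> ('b \<Rightarrow>\<^sub>0 Kq) \<Rightarrow> 'b \<Rightarrow>\<^sub>0 Kq" where
  "smul c x = Poly_Mapping.map ((*) c) x"

definition lin_ext :: "('b \<Rightarrow> 'c \<Rightarrow>\<^sub>0 Kq) \<Rightarrow> ('b \<Rightarrow>\<^sub>0 Kq) \<Rightarrow> 'c \<Rightarrow>\<^sub>0 Kq" where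
  "lin_ext f x = (\<Sum>b\<in>keys x. smul (lookup x b) (f b))"


section \<open>Roots and parities\<close>

text \<open>Throughout, \<open>p i\<close> is the parity (0 or 1) of the basis vector \<open>v\<^sub>i\<close>, for \<open>i\<close> in \<open>{1..N}\<close>.
  A weight is its family of integer coefficients: index \<open>i\<close> in \<open>{1..N}\<close> is the coefficient of
  \<open>\<epsilon>\<^sub>i\<close>, and index 0 is the coefficient of \<open>\<delta>\<close>, which lies in the radical of the form.\<close>

type_synonym weight = "nat \<Rightarrow> int"

definition eps :: "nat \<Rightarrow> weight" where
  "eps i = (\<lambda>k. if k = i then 1 else 0)"

definition delta :: weight where
  "delta = (\<lambda>k. if k = 0 then 1 else 0)"

definition wform :: "nat \<Rightarrow> (nat \<Rightarrow> nat) \<Rightarrow> weight \<Rightarrow> weight \<Rightarrow> int" where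
  "wform N p x y = (\<Sum>i=1..N. (-1) ^ p i * x i * y i)"

definition alpha :: "nat \<Rightarrow> nat \<Rightarrow> weight" where
  "alpha N i = (if i = 0 then (\<lambda>k. delta k - (eps 1 k - eps N k))
                else (\<lambda>k. eps i k - eps (i + 1) k))"

definition cartan :: "nat \<Rightarrow> (nat \<Rightarrow> nat) \<Rightarrow> nat \<Rightarrow> nat \<Rightarrow> int" where
  "cartan N p i j = wform N p (alpha N i) (alpha N j)"

definition rpar :: "nat \<Rightarrow> (nat \<Rightarrow> nat) \<Rightarrow> nat \<Rightarrow> nat" where
  "rpar N p i = (if i = 0 then p 1 + p N else p i + p (i + 1)) mod 2"


section \<open>The free superalgebra on the generators\<close>

text \<open>\<open>gH i\<close> and \<open>gHinv i\<close> stand for \<open>q\<^sup>h\<^sup>/\<^sup>2\<close> and \<open>q\<^sup>-\<^sup>h\<^sup>/\<^sup>2\<close> with \<open>h = h\<^sub>i\<close>.\<close>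

datatype gen = gE nat | gF nat | gH nat | gHinv nat | gGamma | gGammainv | gD | gDinv

definition gens :: "nat \<Rightarrow> gen set" where
  "gens N = gE ` {..<N} \<union> gF ` {..<N} \<union> gH ` {..<N} \<union> gHinv ` {..<N}
            \<union> {gGamma, gGammainv, gD, gDinv}"

text \<open>Words under concatenation, written additively, so that the convolution product of
  \<open>gen fword \<Rightarrow>\<^sub>0 Kq\<close> is the product of the free associative algebra.\<close>

datatype 'a fword = Wd (letters: "'a list")

instantiation fword :: (type) monoid_add
begin

definition zero_fword :: "'a fword" where
  "0 = Wd []"

definition plus_fword :: "'a fword \<Rightarrow> 'a fword \<Rightarrow> 'a fword" where
  "x + y = Wd (letters x @ letters y)"

instance
  by standard (auto simp: zero_fword_def plus_fword_def)

end

type_synonym falg = "gen fword \<Rightarrow>\<^sub>0 Kq"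

definition free_alg :: "nat \<Rightarrow> falg ring" where
  "free_alg N = \<lparr>carrier = {x. \<forall>w\<in>keys x. set (letters w) \<subseteq> gens N},
                 monoid.mult = (*), one = 1, zero = 0, add = (+)\<rparr>"

definition g1 :: "gen \<Rightarrow> falg" where
  "g1 g = sgl (Wd [g]) 1"

fun gpar :: "nat \<Rightarrow> (nat \<Rightarrow> nat) \<Rightarrow> gen \<Rightarrow> nat" where
  "gpar N p (gE i) = rpar N p i"
| "gpar N p (gF i) = rpar N p i"
| "gpar N p _ = 0"

fun gdeg :: "nat \<Rightarrow> gen \<Rightarrow> weight" where
  "gdeg N (gE i) = alpha N i"
| "gdeg N (gF i) = (\<lambda>k. - alpha N i k)"
| "gdeg N _ = (\<lambda>k. 0)"

definition wpar :: "nat \<Rightarrow> (nat \<Rightarrow> nat) \<Rightarrow> gen fword \<Rightarrow> nat" where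
  "wpar N p w = (\<Sum>g\<leftarrow>letters w. gpar N p g) mod 2"

definition wdeg :: "nat \<Rightarrow> gen fword \<Rightarrow> weight" where
  "wdeg N w = (\<lambda>k. \<Sum>g\<leftarrow>letters w. gdeg N g k)"

text \<open>The bilinear extension of
  \<open>\<lbrakk>x,y\<rbrakk> = xy - (-1)\<^bsup>|x||y|\<^esup> q\<^bsup>(deg x,deg y)\<^esup> yx\<close> from words \<open>x\<close>, \<open>y\<close>.\<close>

definition qbr :: "nat \<Rightarrow> (nat \<Rightarrow> nat) \<Rightarrow> falg \<Rightarrow> falg \<Rightarrow> falg" where
  "qbr N p x y = (\<Sum>v\<in>keys x. \<Sum>w\<in>keys y. smul (lookup x v * lookup y w)
     (sgl (v + w) 1
      - sgl (w + v) ((-1) ^ (wpar N p v * wpar N p w) * q powi wform N p (wdeg N v) (wdeg N w))))"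


section \<open>The quantum affine superalgebra\<close>

text \<open>A relation \<open>l = r\<close> is recorded as the element \<open>l - r\<close> of the free algebra.\<close>

inductive_set relators :: "nat \<Rightarrow> (nat \<Rightarrow> nat) \<Rightarrow> falg set"
  for N :: nat and p :: "nat \<Rightarrow> nat" where
  D_inv: "g1 gD * g1 gDinv - 1 \<in> relators N p"
| D_inv': "g1 gDinv * g1 gD - 1 \<in> relators N p"
| D_H: "i < N \<Longrightarrow> g1 gD * g1 (gH i) - g1 (gH i) * g1 gD \<in> relators N p"
| D_E: "i < N \<Longrightarrow> g1 gD * g1 (gE i) * g1 gDinv
          - smul (if i = 0 then q else 1) (g1 (gE i)) \<in> relators N p"
| D_F: "i < N \<Longrightarrow> g1 gD * g1 (gF i) * g1 gDinv
          - smul (if i = 0 then inverse q else 1) (g1 (gF i)) \<in> relators N p"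
| Gamma_inv: "g1 gGamma * g1 gGammainv - 1 \<in> relators N p"
| Gamma_inv': "g1 gGammainv * g1 gGamma - 1 \<in> relators N p"
| Gamma_prod: "g1 gGamma - prod_list (map (\<lambda>i. g1 (gH i)) [0..<N]) \<in> relators N p"
| Gamma_central: "g \<in> gens N \<Longrightarrow> g1 gGamma * g1 g - g1 g * g1 gGamma \<in> relators N p"
| H_H: "i < N \<Longrightarrow> j < N \<Longrightarrow>
          g1 (gH i) * g1 (gH j) - g1 (gH j) * g1 (gH i) \<in> relators N p"
| H_inv: "i < N \<Longrightarrow> g1 (gH i) * g1 (gHinv i) - 1 \<in> relators N p"
| H_inv': "i < N \<Longrightarrow> g1 (gHinv i) * g1 (gH i) - 1 \<in> relators N p"
| H_E: "i < N \<Longrightarrow> j < N \<Longrightarrow> g1 (gH i) * g1 (gE j) * g1 (gHinv i)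
          - smul (qh powi cartan N p i j) (g1 (gE j)) \<in> relators N p"
| H_F: "i < N \<Longrightarrow> j < N \<Longrightarrow> g1 (gH i) * g1 (gF j) * g1 (gHinv i)
          - smul (qh powi (- cartan N p i j)) (g1 (gF j)) \<in> relators N p"
| E_F: "i < N \<Longrightarrow> j < N \<Longrightarrow>
          g1 (gE i) * g1 (gF j)
          - smul ((-1) ^ (rpar N p i * rpar N p j)) (g1 (gF j) * g1 (gE i))
          - (if i = j then smul (inverse (q - inverse q)) (g1 (gH i) ^ 2 - g1 (gHinv i) ^ 2) else 0)
          \<in> relators N p"
| Serre1: "i < N \<Longrightarrow> j < N \<Longrightarrow> cartan N p i j = 0 \<Longrightarrow> X \<in> {gE, gF} \<Longrightarrow>
          qbr N p (g1 (X i)) (g1 (X j)) \<in> relators N p"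
| Serre2: "i < N \<Longrightarrow> j = (i + 1) mod N \<or> j = (i + N - 1) mod N \<Longrightarrow> rpar N p i = 0 \<Longrightarrow>
          X \<in> {gE, gF} \<Longrightarrow>
          qbr N p (g1 (X i)) (qbr N p (g1 (X i)) (g1 (X j))) \<in> relators N p"
| Serre3: "i < N \<Longrightarrow> rpar N p i = 1 \<Longrightarrow> X \<in> {gE, gF} \<Longrightarrow>
          qbr N p (qbr N p (qbr N p (g1 (X ((i + N - 1) mod N))) (g1 (X i)))
            (g1 (X ((i + 1) mod N)))) (g1 (X i)) \<in> relators N p"
| Serre4: "card {i \<in> {1..N}. p i = 0} * card {i \<in> {1..N}. p i = 1} = 2 \<Longrightarrow>
          i < N \<Longrightarrow> j < N \<Longrightarrow> k < N \<Longrightarrow> {i, j, k} = {0, 1, 2} \<Longrightarrow>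
          rpar N p i = 0 \<Longrightarrow> rpar N p j = 1 \<Longrightarrow> rpar N p k = 1 \<Longrightarrow> X \<in> {gE, gF} \<Longrightarrow>
          qbr N p (g1 (X j)) (qbr N p (g1 (X k)) (qbr N p (g1 (X j)) (qbr N p (g1 (X k)) (g1 (X i)))))
          - qbr N p (g1 (X k)) (qbr N p (g1 (X j)) (qbr N p (g1 (X k)) (qbr N p (g1 (X j)) (g1 (X i)))))
          \<in> relators N p"

text \<open>The scalars lie in the free algebra, so the two-sided ring ideal generated by the relators is
  the algebra ideal.  The elements of \<open>Uq N p\<close> are the cosets of this ideal.\<close>

definition Uq :: "nat \<Rightarrow> (nat \<Rightarrow> nat) \<Rightarrow> (falg set) ring" where
  "Uq N p = free_alg N Quot (genideal (free_alg N) (relators N p))"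


section \<open>Coproduct\<close>

text \<open>The graded tensor square has the pairs of words as its basis, with product
  \<open>(x \<otimes> y)(x' \<otimes> y') = (-1)\<^bsup>|y||x'|\<^esup> xx' \<otimes> yy'\<close>.\<close>

type_synonym falg2 = "(gen fword \<times> gen fword) \<Rightarrow>\<^sub>0 Kq"

definition gmult :: "nat \<Rightarrow> (nat \<Rightarrow> nat) \<Rightarrow> falg2 \<Rightarrow> falg2 \<Rightarrow> falg2" where
  "gmult N p P Q = (\<Sum>(x, y)\<in>keys P. \<Sum>(x', y')\<in>keys Q.
     sgl (x + x', y + y')
       ((-1) ^ (wpar N p y * wpar N p x') * lookup P (x, y) * lookup Q (x', y')))"

definition gg :: "gen \<Rightarrow> gen \<Rightarrow> falg2" where
  "gg g h = sgl (Wd [g], Wd [h]) 1"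

fun coprod_gen :: "gen \<Rightarrow> falg2" where
  "coprod_gen (gE i) = gg (gH i) (gE i) + gg (gE i) (gHinv i)"
| "coprod_gen (gF i) = gg (gH i) (gF i) + gg (gF i) (gHinv i)"
| "coprod_gen g = gg g g"

definition coprod_word :: "nat \<Rightarrow> (nat \<Rightarrow> nat) \<Rightarrow> gen fword \<Rightarrow> falg2" where
  "coprod_word N p w = foldr (\<lambda>g P. gmult N p (coprod_gen g) P) (letters w) (sgl (0, 0) 1)"

definition coprod :: "nat \<Rightarrow> (nat \<Rightarrow> nat) \<Rightarrow> falg \<Rightarrow> falg2" where
  "coprod N p = lin_ext (coprod_word N p)"


section \<open>Evaluation modules and their tensor products\<close>

text \<open>The basis vector \<open>(i, k)\<close> of \<open>V(u)\<close> is \<open>v\<^sub>i \<otimes> u\<^sup>k\<close>, where \<open>i \<in> {1..N}\<close>; \<open>munit i j r c\<close>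
  is the operator \<open>c u\<^sup>r E\<^sub>i\<^sub>j\<close>, given on the basis.\<close>

type_synonym evb = "nat \<times> int"

definition munit :: "nat \<Rightarrow> nat \<Rightarrow> int \<Rightarrow> Kq \<Rightarrow> evb \<Rightarrow> evb \<Rightarrow>\<^sub>0 Kq" where
  "munit i j r c = (\<lambda>(l, k). if l = j then sgl (i, k + r) c else 0)"

text \<open>The eigenvalue on \<open>v\<^sub>l\<close> of the diagonal matrix representing \<open>h\<^sub>i\<close>.\<close>

definition hval :: "nat \<Rightarrow> (nat \<Rightarrow> nat) \<Rightarrow> nat \<Rightarrow> nat \<Rightarrow> int" where
  "hval N p i l =
    (if i = 0 then - ((-1) ^ p 1 * of_bool (l = 1) - (-1) ^ p N * of_bool (l = N))
     else (-1) ^ p i * of_bool (l = i) - (-1) ^ p (i + 1) * of_bool (l = i + 1))"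

fun ev_gen :: "nat \<Rightarrow> (nat \<Rightarrow> nat) \<Rightarrow> complex \<Rightarrow> complex \<Rightarrow> gen \<Rightarrow> evb \<Rightarrow> evb \<Rightarrow>\<^sub>0 Kq" where
  "ev_gen N p a b (gE i) = (if i = 0 then munit N 1 1 (of_C a) else munit i (i + 1) 0 1)"
| "ev_gen N p a b (gF i) =
     (if i = 0 then munit 1 N (-1) (of_C b) else munit (i + 1) i 0 ((-1) ^ p i))"
| "ev_gen N p a b (gH i) = (\<lambda>(l, k). sgl (l, k) (qh powi hval N p i l))"
| "ev_gen N p a b (gHinv i) = (\<lambda>(l, k). sgl (l, k) (qh powi (- hval N p i l)))"
| "ev_gen N p a b gGamma = (\<lambda>(l, k). sgl (l, k) 1)"
| "ev_gen N p a b gGammainv = (\<lambda>(l, k). sgl (l, k) 1)"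
| "ev_gen N p a b gD = (\<lambda>(l, k). sgl (l, k) (q powi k))"
| "ev_gen N p a b gDinv = (\<lambda>(l, k). sgl (l, k) (q powi (- k)))"

definition ev_word ::
  "nat \<Rightarrow> (nat \<Rightarrow> nat) \<Rightarrow> complex \<Rightarrow> complex \<Rightarrow> gen fword \<Rightarrow> (evb \<Rightarrow>\<^sub>0 Kq) \<Rightarrow> evb \<Rightarrow>\<^sub>0 Kq" where
  "ev_word N p a b w = foldr (\<lambda>g T. lin_ext (ev_gen N p a b g) \<circ> T) (letters w) id"

text \<open>\<open>V(u) \<otimes> V(v)\<close> and \<open>V(v) \<otimes> V(u)\<close> are both identified with \<open>V \<otimes> V\<close> tensored with the Laurent
  polynomials in \<open>u\<close> and \<open>v\<close>: the basis vector \<open>(i, j, k, l)\<close> is \<open>v\<^sub>i \<otimes> v\<^sub>j\<close> times \<open>u\<^sup>k v\<^sup>l\<close>.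
  The maps \<open>tens_uv\<close> and \<open>tens_vu\<close> send a pair of vectors of \<open>V(u) \<times> V(v)\<close>,
  respectively of \<open>V(v) \<times> V(u)\<close>, to its tensor product.\<close>

type_synonym evb2 = "nat \<times> nat \<times> int \<times> int"

definition tens_uv :: "(evb \<Rightarrow>\<^sub>0 Kq) \<Rightarrow> (evb \<Rightarrow>\<^sub>0 Kq) \<Rightarrow> evb2 \<Rightarrow>\<^sub>0 Kq" where
  "tens_uv x y = (\<Sum>(i, k)\<in>keys x. \<Sum>(j, l)\<in>keys y.
     sgl (i, j, k, l) (lookup x (i, k) * lookup y (j, l)))"

definition tens_vu :: "(evb \<Rightarrow>\<^sub>0 Kq) \<Rightarrow> (evb \<Rightarrow>\<^sub>0 Kq) \<Rightarrow> evb2 \<Rightarrow>\<^sub>0 Kq" where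
  "tens_vu x y = (\<Sum>(i, l)\<in>keys x. \<Sum>(j, k)\<in>keys y.
     sgl (i, j, k, l) (lookup x (i, l) * lookup y (j, k)))"

definition VV :: "nat \<Rightarrow> (evb2 \<Rightarrow>\<^sub>0 Kq) set" where
  "VV N = {w. keys w \<subseteq> {1..N} \<times> {1..N} \<times> UNIV \<times> UNIV}"

text \<open>The operators \<open>(\<rho>\<^sub>u \<otimes> \<rho>\<^sub>v)(x)\<close> and \<open>(\<rho>\<^sub>v \<otimes> \<rho>\<^sub>u)(x)\<close> given by \<open>\<Delta>(x)\<close>, with the sign rule
  \<open>(X \<otimes> Y)(v \<otimes> w) = (-1)\<^bsup>|Y||v|\<^esup> Xv \<otimes> Yw\<close>.  Here \<open>x\<close> is an element of the free algebra; an
  element of \<open>Uq N p\<close> acts through its representatives.\<close>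

definition act_uv ::
  "nat \<Rightarrow> (nat \<Rightarrow> nat) \<Rightarrow> complex \<Rightarrow> complex \<Rightarrow> falg \<Rightarrow> (evb2 \<Rightarrow>\<^sub>0 Kq) \<Rightarrow> evb2 \<Rightarrow>\<^sub>0 Kq" where
  "act_uv N p a b x = lin_ext (\<lambda>(i, j, k, l).
     lin_ext (\<lambda>(w1, w2). smul ((-1) ^ (wpar N p w2 * p i))
       (tens_uv (ev_word N p a b w1 (sgl (i, k) 1)) (ev_word N p a b w2 (sgl (j, l) 1))))
     (coprod N p x))"

definition act_vu ::
  "nat \<Rightarrow> (nat \<Rightarrow> nat) \<Rightarrow> complex \<Rightarrow> complex \<Rightarrow> falg \<Rightarrow> (evb2 \<Rightarrow>\<^sub>0 Kq) \<Rightarrow> evb2 \<Rightarrow>\<^sub>0 Kq" where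
  "act_vu N p a b x = lin_ext (\<lambda>(i, j, k, l).
     lin_ext (\<lambda>(w1, w2). smul ((-1) ^ (wpar N p w2 * p i))
       (tens_vu (ev_word N p a b w1 (sgl (i, l) 1)) (ev_word N p a b w2 (sgl (j, k) 1))))
     (coprod N p x))"


section \<open>The R-matrix\<close>

definition tau :: "(nat \<Rightarrow> nat) \<Rightarrow> (evb2 \<Rightarrow>\<^sub>0 Kq) \<Rightarrow> evb2 \<Rightarrow>\<^sub>0 Kq" where
  "tau p = lin_ext (\<lambda>(i, j, k, l). sgl (j, i, k, l) ((-1) ^ (p i * p j)))"

text \<open>\<open>EE p i j r s\<close> is the graded tensor product of the matrix units \<open>E\<^sub>i\<^sub>j\<close> and \<open>E\<^sub>r\<^sub>s\<close>.\<close>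

definition EE ::
  "(nat \<Rightarrow> nat) \<Rightarrow> nat \<Rightarrow> nat \<Rightarrow> nat \<Rightarrow> nat \<Rightarrow> (evb2 \<Rightarrow>\<^sub>0 Kq) \<Rightarrow> evb2 \<Rightarrow>\<^sub>0 Kq" where
  "EE p i j r s = lin_ext (\<lambda>(c, d, k, l).
     if c = j \<and> d = s then sgl (i, r, k, l) ((-1) ^ ((p r + p s) * p c)) else 0)"

definition mult_z :: "(evb2 \<Rightarrow>\<^sub>0 Kq) \<Rightarrow> evb2 \<Rightarrow>\<^sub>0 Kq" where
  "mult_z = lin_ext (\<lambda>(i, j, k, l). sgl (i, j, k + 1, l - 1) 1)"

definition Rbraces :: "nat \<Rightarrow> (nat \<Rightarrow> nat) \<Rightarrow> (evb2 \<Rightarrow>\<^sub>0 Kq) \<Rightarrow> evb2 \<Rightarrow>\<^sub>0 Kq" where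
  "Rbraces N p w = w
     + smul (qh - inverse qh)
         (\<Sum>i=1..N. smul ((-1) ^ p i * qh powi wform N p (eps i) (eps i)) (EE p i i i i w))
     + smul (q - inverse q)
         (\<Sum>(i, j)\<in>{(i, j). i \<in> {1..N} \<and> j \<in> {1..N} \<and> i > j}. smul ((-1) ^ p j) (EE p i j j i w))"

text \<open>\<open>R(z)\<close> and \<open>\<tau> \<circ> R(z)\<close> at \<open>z = u/v\<close>.\<close>

definition Rmat :: "nat \<Rightarrow> (nat \<Rightarrow> nat) \<Rightarrow> (evb2 \<Rightarrow>\<^sub>0 Kq) \<Rightarrow> evb2 \<Rightarrow>\<^sub>0 Kq" where
  "Rmat N p w = (mult_z (Rbraces N p w) - Rbraces N p w) + smul (q - inverse q) (tau p w)"

definition Rhat :: "nat \<Rightarrow> (nat \<Rightarrow> nat) \<Rightarrow> (evb2 \<Rightarrow>\<^sub>0 Kq) \<Rightarrow> evb2 \<Rightarrow>\<^sub>0 Kq" where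
  "Rhat N p = tau p \<circ> Rmat N p"


section \<open>The relators lie in the free algebra\<close>

abbreviation fcar :: "nat \<Rightarrow> falg set" where
  "fcar N \<equiv> carrier (free_alg N)"

lemma fcar_iff: "x \<in> fcar N \<longleftrightarrow> (\<forall>w\<in>keys x. set (letters w) \<subseteq> gens N)"
  by (simp add: free_alg_def)

lemma fcar_add: "x \<in> fcar N \<Longrightarrow> y \<in> fcar N \<Longrightarrow> x + y \<in> fcar N"
  using Poly_Mapping.keys_add[of x y] by (auto simp: fcar_iff)

lemma fcar_uminus: "x \<in> fcar N \<Longrightarrow> - x \<in> fcar N"
  by (auto simp: fcar_iff)

lemma fcar_diff: "x \<in> fcar N \<Longrightarrow> y \<in> fcar N \<Longrightarrow> x - y \<in> fcar N"
  using fcar_add[of x N "- y"] fcar_uminus[of y N] by simp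

lemma fcar_0: "0 \<in> fcar N"
  by (simp add: fcar_iff)

lemma fcar_1: "1 \<in> fcar N"
  by (simp add: fcar_iff zero_fword_def)

lemma fcar_mult: "x \<in> fcar N \<Longrightarrow> y \<in> fcar N \<Longrightarrow> x * y \<in> fcar N"
  using keys_mult[of x y] by (fastforce simp: fcar_iff plus_fword_def)

lemma fcar_smul: "x \<in> fcar N \<Longrightarrow> smul c x \<in> fcar N"
  by (auto simp: fcar_iff smul_def in_keys_iff Poly_Mapping.map.rep_eq when_def)

lemma fcar_sum: "(\<And>i. i \<in> A \<Longrightarrow> f i \<in> fcar N) \<Longrightarrow> sum f A \<in> fcar N"
  by (induction A rule: infinite_finite_induct) (auto simp: fcar_0 fcar_add)

lemma fcar_g1: "g \<in> gens N \<Longrightarrow> g1 g \<in> fcar N"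
  by (simp add: fcar_iff g1_def)

lemma fcar_qbr: "x \<in> fcar N \<Longrightarrow> y \<in> fcar N \<Longrightarrow> qbr N p x y \<in> fcar N"
  unfolding qbr_def
  by (intro fcar_sum fcar_smul fcar_diff) (auto simp: fcar_iff plus_fword_def)

lemma fcar_prod_list: "(\<And>x. x \<in> set xs \<Longrightarrow> x \<in> fcar N) \<Longrightarrow> prod_list xs \<in> fcar N"
  by (induction xs) (auto simp: fcar_1 fcar_mult)

lemma free_alg_ops:
  "x \<otimes>\<^bsub>free_alg N\<^esub> y = x * y" "x \<oplus>\<^bsub>free_alg N\<^esub> y = x + y"
  "\<one>\<^bsub>free_alg N\<^esub> = 1" "\<zero>\<^bsub>free_alg N\<^esub> = 0"
  by (simp_all add: free_alg_def)

lemma ring_free_alg: "ring (free_alg N)"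
proof (rule ringI)
  show "abelian_group (free_alg N)"
  proof (rule abelian_groupI, unfold free_alg_ops)
    fix x assume "x \<in> fcar N"
    thus "\<exists>y\<in>fcar N. y + x = 0"
      by (intro bexI[of _ "- x"] fcar_uminus) simp_all
  qed (simp_all only: fcar_add fcar_0 ac_simps add_0_left add_0_right)
  show "monoid (free_alg N)"
    by (rule monoidI, unfold free_alg_ops)
      (simp_all only: fcar_mult fcar_1 mult.assoc mult_1_left mult_1_right)
qed (simp_all only: free_alg_ops distrib_left distrib_right)

lemma gens_intros:
  "i < N \<Longrightarrow> gE i \<in> gens N" "i < N \<Longrightarrow> gF i \<in> gens N"
  "i < N \<Longrightarrow> gH i \<in> gens N" "i < N \<Longrightarrow> gHinv i \<in> gens N"
  "gGamma \<in> gens N" "gGammainv \<in> gens N" "gD \<in> gens N" "gDinv \<in> gens N"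
  by (auto simp: gens_def)

lemma gens_E_F: "i < N \<Longrightarrow> X \<in> {gE, gF} \<Longrightarrow> X i \<in> gens N"
  by (auto simp: gens_def)

lemma fcar_gH_prod: "prod_list (map (\<lambda>i. g1 (gH i)) [0..<N]) \<in> fcar N"
  by (rule fcar_prod_list) (auto simp: fcar_g1 gens_intros)

lemmas fcar_intros = fcar_diff fcar_mult fcar_smul fcar_qbr fcar_1 fcar_0 fcar_gH_prod fcar_g1

lemma relators_carrier: "relators N p \<subseteq> fcar N"
proof
  fix x assume "x \<in> relators N p"
  thus "x \<in> fcar N"
  proof cases
    case (E_F i j)
    have "(if i = j then smul (inverse (q - inverse q)) (g1 (gH i) ^ 2 - g1 (gHinv i) ^ 2) else 0)
          \<in> fcar N"
      using E_F by (simp add: power2_eq_square fcar_intros gens_intros)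
    with E_F show ?thesis
      by (simp add: fcar_intros gens_intros)
  next
    case (Serre2 i j X)
    hence "j < N" by auto
    thus ?thesis unfolding Serre2(1) using Serre2
      by (intro fcar_qbr fcar_g1 gens_E_F)
  next
    case (Serre3 i X)
    hence "(i + 1) mod N < N" "(i + N - 1) mod N < N" by auto
    thus ?thesis unfolding Serre3(1) using Serre3
      by (intro fcar_qbr fcar_g1 gens_E_F)
  next
    case (Serre1 i j X)
    thus ?thesis unfolding Serre1(1) using Serre1
      by (intro fcar_qbr fcar_g1 gens_E_F)
  next
    case (Serre4 i j k X)
    thus ?thesis unfolding Serre4(1) using Serre4
      by (intro fcar_diff fcar_qbr fcar_g1 gens_E_F)
  qed (simp_all add: fcar_intros gens_intros)
qed

lemma Uq_representative:
  assumes "X \<in> carrier (Uq N p)" and "x \<in> X"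
  shows "x \<in> carrier (free_alg N)"
proof -
  interpret ring "free_alg N" by (rule ring_free_alg)
  interpret ideal "genideal (free_alg N) (relators N p)" "free_alg N"
    by (rule genideal_ideal[OF relators_carrier])
  from assms obtain y
    where "y \<in> fcar N" "x \<in> genideal (free_alg N) (relators N p) +>\<^bsub>free_alg N\<^esub> y"
    by (auto simp: Uq_def FactRing_def A_RCOSETS_def')
  thus ?thesis
    using a_r_coset_subset_G[OF a_subset] by blast
qed

end

theory Submission
  imports Defs
begin

text \<open>The actions of the algebra on \<open>V(u) \<otimes> V(v)\<close> and on \<open>V(v) \<otimes> V(u)\<close> are linear, and they are
  multiplicative because the sign in the product of the graded tensor square is the one that appears
  when \<open>X' \<otimes> Y'\<close> and then \<open>X \<otimes> Y\<close> are applied to \<open>v \<otimes> w\<close> (\<open>op_uv_gmult\<close>).  So the set of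
  intertwining elements is closed under products and linear combinations, and
  it suffices to treat the generators (\<open>intertwines_gen\<close>).

  On a basis vector the R-matrix has a simple form (\<open>Rhat_sgl\<close>).  For \<open>c \<noteq> d\<close>,
  the image of \<open>v\<^sub>c \<otimes> v\<^sub>d\<close> is
  \<open>(z - 1) \<tau>(v\<^sub>c \<otimes> v\<^sub>d) + (q - q\<^sup>-\<^sup>1) z\<^bsup>[c < d]\<^esup> v\<^sub>c \<otimes> v\<^sub>d\<close>,
  where \<open>[c < d]\<close> is 1 or 0, and \<open>v\<^sub>c \<otimes> v\<^sub>c\<close> is an eigenvector with eigenvalue \<open>zq - q\<^sup>-\<^sup>1\<close> or
  \<open>q - zq\<^sup>-\<^sup>1\<close>, according to the parity of \<open>c\<close>.

  The Cartan generators, \<open>\<gamma>\<close> and \<open>D\<close> act by scalars that depend only on the unordered pair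
  \<open>{c, d}\<close> and on the total degree in \<open>u\<close> and \<open>v\<close>, both of which the R-matrix preserves
  (\<open>Rhat_diagonal\<close>).  Each \<open>e\<^sub>i\<close> and \<open>f\<^sub>i\<close> acts through one matrix unit \<open>E\<^sub>t\<^sub>s\<close> times a power \<open>u\<^sup>r\<close>
  of the spectral parameter.  For \<open>0 < i\<close> the indices \<open>s\<close> and \<open>t\<close> are adjacent and \<open>r = 0\<close>, so that
  replacing \<open>s\<close> by \<open>t\<close> does not affect the comparison with any third index.  For \<open>i = 0\<close> they are
  the first and the last index: every such comparison changes, and the factor \<open>u\<^sup>r\<close>, which becomes
  \<open>v\<^sup>r\<close> on the other side, compensates this change in \<open>z\<^bsup>[c < d]\<^esup>\<close>.  This makes a single computation
  suffice for all nodes of the affine diagram (\<open>Rhat_root_op\<close>).\<close>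


section \<open>Linear maps on spaces with a basis\<close>

lemma lookup_smul [simp]: "lookup (smul c x) b = c * lookup x b"
  by (simp add: smul_def Poly_Mapping.map.rep_eq when_def)

lemma smul_sgl [simp]: "smul c (sgl b d) = sgl b (c * d)"
  by (rule poly_mapping_eqI) (simp add: lookup_single when_def)

lemma module_smul: "module smul"
  by standard (auto intro!: poly_mapping_eqI simp: lookup_add algebra_simps)

abbreviation klinear :: "(('b \<Rightarrow>\<^sub>0 Kq) \<Rightarrow> 'c \<Rightarrow>\<^sub>0 Kq) \<Rightarrow> bool" where
  "klinear \<equiv> module_hom smul smul"

lemma klinear_iff:
  "klinear T \<longleftrightarrow> (\<forall>x y. T (x + y) = T x + T y) \<and> (\<forall>c x. T (smul c x) = smul c (T x))"
  by (simp add: module_hom_iff module_smul)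

lemma smul_simps [simp]: "smul c 0 = 0" "smul 0 x = 0" "smul 1 x = x"
  "smul c (smul d x) = smul (c * d) x"
  by (auto intro!: poly_mapping_eqI simp: mult.assoc)

lemma smul_add: "smul c (x + y) = smul c x + smul c y"
  and smul_diff: "smul c (x - y) = smul c x - smul c y"
  and smul_add_left: "smul (c + d) x = smul c x + smul d x"
  by (auto intro!: poly_mapping_eqI simp: lookup_add lookup_minus algebra_simps)

lemma smul_sum: "smul c (sum f A) = (\<Sum>a\<in>A. smul c (f a))"
  by (induction A rule: infinite_finite_induct) (auto simp: smul_add)

lemma klinear_0 [simp]: "klinear T \<Longrightarrow> T 0 = 0"
  by (rule module_hom.zero)

lemmas klinear_add = module_hom.add [of smul smul]
lemmas klinear_smul = module_hom.scale [of smul smul]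

lemma lin_ext_superset:
  fixes f :: "'b \<Rightarrow> 'c \<Rightarrow>\<^sub>0 Kq"
  assumes "finite A" "keys x \<subseteq> A"
  shows "lin_ext f x = (\<Sum>b\<in>A. smul (lookup x b) (f b))"
  unfolding lin_ext_def using assms
  by (intro sum.mono_neutral_left) (auto simp: in_keys_iff)

lemma klinear_lin_ext [simp]:
  fixes f :: "'b \<Rightarrow> 'c \<Rightarrow>\<^sub>0 Kq"
  shows "klinear (lin_ext f)"
  unfolding klinear_iff
proof safe
  fix x y :: "'b \<Rightarrow>\<^sub>0 Kq" and c
  let ?A = "keys x \<union> keys y"
  have "lin_ext f (x + y) = (\<Sum>b\<in>?A. smul (lookup (x + y) b) (f b))"
    by (intro lin_ext_superset Poly_Mapping.keys_add) auto
  also have "\<dots> = lin_ext f x + lin_ext f y"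
    by (simp add: lin_ext_superset[of ?A] lookup_add smul_add_left sum.distrib)
  finally show "lin_ext f (x + y) = lin_ext f x + lin_ext f y" .
  have "lin_ext f (smul c x) = (\<Sum>b\<in>keys x. smul (lookup (smul c x) b) (f b))"
    by (intro lin_ext_superset) (auto simp: in_keys_iff)
  thus "lin_ext f (smul c x) = smul c (lin_ext f x)"
    by (simp add: lin_ext_def smul_sum)
qed

lemma lin_ext_sgl [simp]: "lin_ext f (sgl b c) = smul c (f b)"
  by (cases "c = 0") (auto simp: lin_ext_def)

lemma klinear_comp: "klinear S \<Longrightarrow> klinear T \<Longrightarrow> klinear (\<lambda>x. S (T x))"
  by (simp add: klinear_iff)

lemma klinear_intros:
  "klinear S \<Longrightarrow> klinear T \<Longrightarrow> klinear (\<lambda>x. S x + T x)"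
  "klinear S \<Longrightarrow> klinear T \<Longrightarrow> klinear (\<lambda>x. S x - T x)"
  "klinear S \<Longrightarrow> klinear (\<lambda>x. smul c (S x))"
  by (auto simp: klinear_iff smul_add smul_diff ac_simps)

lemma klinear_ident: "klinear (\<lambda>x. x)"
  by (simp add: klinear_iff)

lemma klinear_sum:
  "(\<And>i. i \<in> A \<Longrightarrow> klinear (T i)) \<Longrightarrow> klinear (\<lambda>x. \<Sum>i\<in>A. T i x)"
  by (auto simp: klinear_iff sum.distrib smul_sum)

lemma basis_expansion: "x = (\<Sum>b\<in>keys x. smul (lookup x b) (sgl b 1))"
  by (rule poly_mapping_eqI) (simp add: lookup_sum lookup_single when_def in_keys_iff if_distrib
      cong: if_cong)

lemma klinear_expansion:
  assumes "klinear T"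
  shows "T x = (\<Sum>b\<in>keys x. smul (lookup x b) (T (sgl b 1)))"
proof -
  have "T x = T (\<Sum>b\<in>keys x. smul (lookup x b) (sgl b 1))"
    by (rule arg_cong[OF basis_expansion])
  also have "\<dots> = (\<Sum>b\<in>keys x. T (smul (lookup x b) (sgl b 1)))"
    by (rule module_hom.sum[OF assms])
  finally show ?thesis
    by (simp only: klinear_smul[OF assms])
qed

lemma klinear_eqI:
  assumes "klinear S" "klinear T" "\<And>b. b \<in> keys x \<Longrightarrow> S (sgl b 1) = T (sgl b 1)"
  shows "S x = T x"
  unfolding klinear_expansion[OF assms(1), of x] klinear_expansion[OF assms(2), of x]
  using assms(3) by simp

lemma klinear_lin_ext_param:
  "(\<And>b. klinear (F b)) \<Longrightarrow> klinear (\<lambda>P. lin_ext (\<lambda>b. F b P) w)"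
  unfolding lin_ext_def by (intro klinear_sum klinear_intros)


section \<open>Multiplicativity of the tensor product action\<close>

lemma klinear_ev_word [simp]: "klinear (ev_word N p a b w)"
proof -
  have "klinear (foldr (\<lambda>g T. lin_ext (ev_gen N p a b g) \<circ> T) gs id)" for gs
    by (induction gs) (auto simp: id_def o_def intro: klinear_comp[OF klinear_lin_ext] klinear_ident)
  thus ?thesis by (simp add: ev_word_def)
qed

lemma ev_word_Nil [simp]: "ev_word N p a b 0 x = x"
  by (simp add: ev_word_def zero_fword_def)

lemma ev_word_Cons:
  "ev_word N p a b (Wd (g # gs)) x = lin_ext (ev_gen N p a b g) (ev_word N p a b (Wd gs) x)"
  by (simp add: ev_word_def)

lemma ev_word_add: "ev_word N p a b (w + w') x = ev_word N p a b w (ev_word N p a b w' x)"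
proof -
  obtain gs gs' where w: "w = Wd gs" "w' = Wd gs'" by (cases w; cases w')
  show ?thesis unfolding w
    by (induction gs) (auto simp: plus_fword_def ev_word_Cons, simp add: ev_word_def)
qed

lemma ev_gen_monomial:
  "\<exists>j m c. ev_gen N p a b g (i, k) = sgl (j, m) c \<and> (c \<noteq> 0 \<longrightarrow> even (p j + p i + gpar N p g))"
proof -
  have munit: "\<exists>j m d. munit t s r c (i, k) = sgl (j, m) d
      \<and> (d \<noteq> 0 \<longrightarrow> (even (p j) = even (p i)) = Q)"
    if "Q = (even (p t) = even (p s))" for t s r c Q
  proof (cases "i = s")
    case True
    thus ?thesis using that by (auto simp: munit_def)
  next
    case False
    thus ?thesis by (auto simp: munit_def intro!: exI[of _ 0])
  qed
  show ?thesis
    by (cases g) (auto simp: rpar_def intro!: munit)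
qed

lemma wpar_Cons: "even (wpar N p (Wd (g # gs)) + gpar N p g + wpar N p (Wd gs))"
  by (simp add: wpar_def) presburger

lemma wpar_add: "even (wpar N p (w + w') + wpar N p w + wpar N p w')"
  by (simp add: wpar_def plus_fword_def) presburger

lemma wpar_0 [simp]: "wpar N p 0 = 0"
  by (simp add: wpar_def zero_fword_def)

text \<open>Words send basis vectors to multiples of basis vectors, which reduces the multiplicativity of the
  tensor product action to a comparison of coefficients.  The parity of a vector that
  survives changes by the parity of the word; this makes the signs match.\<close>

lemma ev_word_monomial:
  "\<exists>j m c. ev_word N p a b w (sgl (i, k) 1) = sgl (j, m) c
     \<and> (c \<noteq> 0 \<longrightarrow> even (p j + p i + wpar N p w))"
proof -
  obtain gs where w: "w = Wd gs" by (cases w)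
  show ?thesis unfolding w
  proof (induction gs)
    case Nil
    show ?case
      by (auto simp: wpar_def ev_word_def)
  next
    case (Cons g gs)
    then obtain j m c where *: "ev_word N p a b (Wd gs) (sgl (i, k) 1) = sgl (j, m) c"
      "c \<noteq> 0 \<longrightarrow> even (p j + p i + wpar N p (Wd gs))" by blast
    obtain j' m' c' where **: "ev_gen N p a b g (j, m) = sgl (j', m') c'"
      "c' \<noteq> 0 \<longrightarrow> even (p j' + p j + gpar N p g)"
      using ev_gen_monomial by blast
    have "ev_word N p a b (Wd (g # gs)) (sgl (i, k) 1) = sgl (j', m') (c * c')"
      by (simp add: ev_word_Cons * **)
    moreover have "even (p j' + p i + wpar N p (Wd (g # gs)))" if "c * c' \<noteq> 0"
      using that *(2) **(2) wpar_Cons[of N p g gs] by simp presburger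
    ultimately show ?case by blast
  qed
qed

lemma tens_uv_sgl [simp]: "tens_uv (sgl (i, k) c) (sgl (j, l) d) = sgl (i, j, k, l) (c * d)"
  by (cases "c = 0"; cases "d = 0") (auto simp: tens_uv_def)

lemma tens_uv_0 [simp]: "tens_uv 0 y = 0" "tens_uv x 0 = 0"
  by (auto simp: tens_uv_def)

text \<open>The action \<open>act_uv\<close> before the coproduct enters, for arbitrary elements of the graded tensor
  square.  It is this action, and not that of the algebra, in which the two summands of
  \<open>\<Delta>(e\<^sub>i)\<close> can be treated separately.\<close>

definition op_uv ::
  "nat \<Rightarrow> (nat \<Rightarrow> nat) \<Rightarrow> complex \<Rightarrow> complex \<Rightarrow> falg2 \<Rightarrow> (evb2 \<Rightarrow>\<^sub>0 Kq) \<Rightarrow> evb2 \<Rightarrow>\<^sub>0 Kq" where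
  "op_uv N p a b P = lin_ext (\<lambda>(i, j, k, l).
     lin_ext (\<lambda>(w1, w2). smul ((-1) ^ (wpar N p w2 * p i))
       (tens_uv (ev_word N p a b w1 (sgl (i, k) 1)) (ev_word N p a b w2 (sgl (j, l) 1)))) P)"

lemma act_uv_op: "act_uv N p a b x = op_uv N p a b (coprod N p x)"
  by (simp add: act_uv_def op_uv_def)

lemma klinear_op_uv [simp]: "klinear (op_uv N p a b P)"
  by (simp add: op_uv_def)

lemma klinear_op_uv_left: "klinear (\<lambda>P. op_uv N p a b P w)"
  unfolding op_uv_def by (intro klinear_lin_ext_param) (auto split: prod.split)

text \<open>In this form the product is visibly bilinear, so that identities may be checked on pairs of words.\<close>

lemma gmult_altdef:
  "gmult N p P Q = lin_ext (\<lambda>(x, y). lin_ext (\<lambda>(x', y').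
     sgl (x + x', y + y') ((-1) ^ (wpar N p y * wpar N p x'))) Q) P"
  by (auto simp: gmult_def lin_ext_def smul_sum mult_ac intro!: sum.cong)

lemma klinear_gmult_left: "klinear (\<lambda>P. gmult N p P Q)"
  by (simp add: gmult_altdef)

lemma klinear_gmult_right: "klinear (\<lambda>Q. gmult N p P Q)"
  unfolding gmult_altdef by (intro klinear_lin_ext_param) (auto split: prod.split)

lemma neg_one_power_cong: "even (x + y) \<Longrightarrow> (-1) ^ x = ((-1) ^ y :: 'a :: ring_1)"
  by (cases "even x") auto

text \<open>The sign \<open>(-1)\<^bsup>|y||x'|\<^esup>\<close> of \<open>(x \<otimes> y)(x' \<otimes> y')\<close> is the one by which moving \<open>y\<close> past
  \<open>x'v\<close> differs from moving it past \<open>v\<close>.\<close>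

lemma op_uv_gmult: "op_uv N p a b (gmult N p P Q) w = op_uv N p a b P (op_uv N p a b Q w)"
proof -
  have words: "op_uv N p a b (gmult N p (sgl (x, y) 1) (sgl (x', y') 1)) (sgl (i, j, k, l) 1)
      = op_uv N p a b (sgl (x, y) 1) (op_uv N p a b (sgl (x', y') 1) (sgl (i, j, k, l) 1))"
    for x y x' y' i j k l
  proof -
    obtain i' k' c where i': "ev_word N p a b x' (sgl (i, k) 1) = sgl (i', k') c"
      "c \<noteq> 0 \<longrightarrow> even (p i' + p i + wpar N p x')"
      using ev_word_monomial by blast
    obtain j' l' d where j': "ev_word N p a b y' (sgl (j, l) 1) = sgl (j', l') d"
      using ev_word_monomial by blast
    obtain i'' k'' c' where i'': "ev_word N p a b x (sgl (i', k') 1) = sgl (i'', k'') c'"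
      using ev_word_monomial by blast
    obtain j'' l'' d' where j'': "ev_word N p a b y (sgl (j', l') 1) = sgl (j'', l'') d'"
      using ev_word_monomial by blast
    have x: "ev_word N p a b x (sgl (i', k') c) = sgl (i'', k'') (c * c')"
      using klinear_smul[OF klinear_ev_word, of N p a b x c "sgl (i', k') 1"] i'' by simp
    have y: "ev_word N p a b y (sgl (j', l') d) = sgl (j'', l'') (d * d')"
      using klinear_smul[OF klinear_ev_word, of N p a b y d "sgl (j', l') 1"] j'' by simp
    have sign: "(-1) ^ (wpar N p y * wpar N p x' + wpar N p (y + y') * p i)
        = ((-1) ^ (wpar N p y' * p i + wpar N p y * p i') :: Kq)" if "c \<noteq> 0"
    proof (rule neg_one_power_cong)
      have "even (p i' + p i + wpar N p x')" using i' that by simp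
      thus "even (wpar N p y * wpar N p x' + wpar N p (y + y') * p i +
            (wpar N p y' * p i + wpar N p y * p i'))"
        using wpar_add[of N p y y'] by (auto simp: even_add)
    qed
    show ?thesis
      using sign
      by (cases "c = 0")
        (auto simp: op_uv_def gmult_altdef ev_word_add i' j' x y i'' j'' power_add mult_ac)
  qed
  show ?thesis
  proof (rule klinear_eqI[of "\<lambda>w. op_uv N p a b (gmult N p P Q) w"
        "\<lambda>w. op_uv N p a b P (op_uv N p a b Q w)"])
    fix v :: evb2
    show "op_uv N p a b (gmult N p P Q) (sgl v 1) = op_uv N p a b P (op_uv N p a b Q (sgl v 1))"
    proof (rule klinear_eqI[of "\<lambda>P. op_uv N p a b (gmult N p P Q) (sgl v 1)"
          "\<lambda>P. op_uv N p a b P (op_uv N p a b Q (sgl v 1))"])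
      fix xy
      show "op_uv N p a b (gmult N p (sgl xy 1) Q) (sgl v 1)
          = op_uv N p a b (sgl xy 1) (op_uv N p a b Q (sgl v 1))"
      proof (rule klinear_eqI[of "\<lambda>Q. op_uv N p a b (gmult N p (sgl xy 1) Q) (sgl v 1)"
            "\<lambda>Q. op_uv N p a b (sgl xy 1) (op_uv N p a b Q (sgl v 1))"])
        fix xy'
        show "op_uv N p a b (gmult N p (sgl xy 1) (sgl xy' 1)) (sgl v 1)
          = op_uv N p a b (sgl xy 1) (op_uv N p a b (sgl xy' 1) (sgl v 1))"
          by (cases xy; cases xy'; cases v) (simp only: words)
      qed (intro klinear_comp[OF klinear_op_uv_left] klinear_comp[OF klinear_op_uv]
          klinear_op_uv_left klinear_gmult_right)+
    qed (intro klinear_comp[OF klinear_op_uv_left] klinear_op_uv_left klinear_gmult_left)+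
  qed (simp_all add: klinear_comp)
qed


lemma wpar_single [simp]: "wpar N p (Wd [g]) = gpar N p g mod 2"
  by (simp add: wpar_def)

lemma ev_word_single [simp]: "ev_word N p a b (Wd [g]) x = lin_ext (ev_gen N p a b g) x"
  by (simp add: ev_word_def)

lemma op_uv_gg:
  "op_uv N p a b (gg g h) (sgl (i, j, k, l) 1) = smul ((-1) ^ (gpar N p h mod 2 * p i))
     (tens_uv (ev_gen N p a b g (i, k)) (ev_gen N p a b h (j, l)))"
  by (simp add: op_uv_def gg_def)

text \<open>Since both tensor products live on the same space, the action on \<open>V(v) \<otimes> V(u)\<close> is the conjugate
  of the one on \<open>V(u) \<otimes> V(v)\<close> by the exchange of the two variables.\<close>

definition swap_uv :: "(evb2 \<Rightarrow>\<^sub>0 Kq) \<Rightarrow> evb2 \<Rightarrow>\<^sub>0 Kq" where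
  "swap_uv = lin_ext (\<lambda>(i, j, k, l). sgl (i, j, l, k) 1)"

lemma klinear_swap_uv [simp]: "klinear swap_uv"
  by (simp add: swap_uv_def)

lemma swap_uv_sgl [simp]: "swap_uv (sgl (i, j, k, l) c) = sgl (i, j, l, k) c"
  by (simp add: swap_uv_def)

lemma swap_uv_swap_uv [simp]: "swap_uv (swap_uv w) = w"
  by (rule klinear_eqI[OF klinear_comp[OF klinear_swap_uv klinear_swap_uv] klinear_ident]) auto

definition op_vu ::
  "nat \<Rightarrow> (nat \<Rightarrow> nat) \<Rightarrow> complex \<Rightarrow> complex \<Rightarrow> falg2 \<Rightarrow> (evb2 \<Rightarrow>\<^sub>0 Kq) \<Rightarrow> evb2 \<Rightarrow>\<^sub>0 Kq" where
  "op_vu N p a b P w = swap_uv (op_uv N p a b P (swap_uv w))"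

lemma klinear_op_vu [simp]: "klinear (op_vu N p a b P)"
  unfolding op_vu_def by (intro klinear_comp[OF klinear_swap_uv]
      klinear_comp[OF klinear_op_uv] klinear_swap_uv)

lemma klinear_op_vu_left: "klinear (\<lambda>P. op_vu N p a b P w)"
  unfolding op_vu_def by (rule klinear_comp[OF klinear_swap_uv klinear_op_uv_left])

lemma op_vu_gmult: "op_vu N p a b (gmult N p P Q) w = op_vu N p a b P (op_vu N p a b Q w)"
  by (simp add: op_vu_def op_uv_gmult)

lemma act_vu_op: "act_vu N p a b x w = op_vu N p a b (coprod N p x) w"
proof (rule klinear_eqI[of "act_vu N p a b x"])
  fix v :: evb2
  obtain i j k l where v: "v = (i, j, k, l)" by (cases v)
  show "act_vu N p a b x (sgl v 1) = op_vu N p a b (coprod N p x) (sgl v 1)"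
    unfolding op_vu_def op_uv_def act_vu_def v swap_uv_sgl lin_ext_sgl prod.case smul_simps
  proof (rule klinear_eqI[OF klinear_lin_ext klinear_comp[OF klinear_swap_uv klinear_lin_ext]])
    fix w :: "gen fword \<times> gen fword"
    obtain w1 w2 where w: "w = (w1, w2)" by (cases w)
    obtain i' l' c where 1: "ev_word N p a b w1 (sgl (i, l) 1) = sgl (i', l') c"
      using ev_word_monomial by blast
    obtain j' k' d where 2: "ev_word N p a b w2 (sgl (j, k) 1) = sgl (j', k') d"
      using ev_word_monomial by blast
    have "tens_vu (sgl (i', l') c) (sgl (j', k') d) = sgl (i', j', k', l') (c * d)"
      by (cases "c = 0"; cases "d = 0") (auto simp: tens_vu_def)
    thus "lin_ext (\<lambda>(w1, w2). smul ((-1) ^ (wpar N p w2 * p i))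
         (tens_vu (ev_word N p a b w1 (sgl (i, l) 1)) (ev_word N p a b w2 (sgl (j, k) 1)))) (sgl w 1)
      = swap_uv (lin_ext (\<lambda>(w1, w2). smul ((-1) ^ (wpar N p w2 * p i))
         (tens_uv (ev_word N p a b w1 (sgl (i, l) 1)) (ev_word N p a b w2 (sgl (j, k) 1)))) (sgl w 1))"
      by (simp add: w 1 2)
  qed
qed (simp_all add: act_vu_def)


section \<open>The R-matrix on basis vectors\<close>

lemma klinear_tau [simp]: "klinear (tau p)"
  and klinear_mult_z [simp]: "klinear mult_z"
  and klinear_EE [simp]: "klinear (EE p i j r s)"
  by (simp_all add: tau_def mult_z_def EE_def)

lemma tau_sgl [simp]: "tau p (sgl (i, j, k, l) x) = sgl (j, i, k, l) (x * (-1) ^ (p i * p j))"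
  by (simp add: tau_def)

lemma mult_z_sgl [simp]: "mult_z (sgl (i, j, k, l) x) = sgl (i, j, k + 1, l - 1) x"
  by (simp add: mult_z_def)

lemma klinear_Rbraces [simp]: "klinear (Rbraces N p)"
  unfolding Rbraces_def
  by (intro klinear_intros klinear_sum klinear_ident) (auto split: prod.split intro!: klinear_intros)

lemma klinear_Rhat [simp]: "klinear (Rhat N p)"
  unfolding Rhat_def Rmat_def o_def
  by (intro klinear_comp[OF klinear_tau] klinear_intros klinear_comp[OF klinear_mult_z]
      klinear_Rbraces klinear_ident klinear_tau)

lemma qh_nonzero [simp]: "qh \<noteq> 0"
  by (simp add: qh_def Zero_fract_def eq_fract)

lemma q_nonzero [simp]: "q \<noteq> 0"
  by (simp add: q_def)

text \<open>The first sum in the braces turns the eigenvalue 1 of \<open>v\<^sub>c \<otimes> v\<^sub>c\<close> into \<open>q\<^sup>\<plusminus>\<^sup>1\<close>; the second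
  agrees with \<open>\<tau>\<close> on the vectors with \<open>c < d\<close> and vanishes on all others.\<close>

lemma Rbraces_sgl:
  assumes "c \<in> {1..N}" "d \<in> {1..N}" "\<forall>i\<in>{1..N}. p i \<in> {0, 1}"
  shows "Rbraces N p (sgl (c, d, k, l) 1) =
    (if c = d then sgl (c, c, k, l) (if p c = 0 then q else inverse q)
     else sgl (c, d, k, l) 1
       + sgl (d, c, k, l) (of_bool (c < d) * (q - inverse q) * (-1) ^ (p c * p d)))"
proof -
  have p: "p c = 0 \<or> p c = 1" "p d = 0 \<or> p d = 1" using assms by auto
  have diag: "(\<Sum>i=1..N. smul ((-1) ^ p i * qh powi wform N p (eps i) (eps i))
        (EE p i i i i (sgl (c, d, k, l) 1)))
      = (if c = d then sgl (c, c, k, l) ((-1) ^ p c * qh powi wform N p (eps c) (eps c)) else 0)"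
    (is "(\<Sum>i=1..N. ?f i) = _")
  proof -
    have "(\<Sum>i=1..N. ?f i) = (\<Sum>i=1..N. if i = c then ?f c else 0)"
      by (intro sum.cong) (auto simp: EE_def)
    thus ?thesis using assms by (simp add: EE_def)
  qed
  have w: "wform N p (eps c) (eps c) = (-1) ^ p c"
  proof -
    have "wform N p (eps c) (eps c) = (\<Sum>i=1..N. if i = c then (-1) ^ p c else 0)"
      unfolding wform_def by (intro sum.cong) (auto simp: eps_def)
    thus ?thesis using assms by simp
  qed
  let ?A = "{(i, j). i \<in> {1..N} \<and> j \<in> {1..N} \<and> i > j}"
  have off: "(\<Sum>(i, j)\<in>?A. smul ((-1) ^ p j) (EE p i j j i (sgl (c, d, k, l) 1)))
      = sgl (d, c, k, l) (of_bool (c < d) * (-1) ^ (p c * p d))"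
    (is "sum ?f ?A = ?g")
  proof -
    have fin: "finite ?A"
      by (rule finite_subset[of _ "{1..N} \<times> {1..N}"]) auto
    have "sum ?f ?A = (\<Sum>x\<in>?A. if x = (d, c) then ?f (d, c) else 0)"
      by (intro sum.cong) (auto simp: EE_def split: if_splits)
    also have "\<dots> = (if (d, c) \<in> ?A then ?f (d, c) else 0)"
      using fin by (simp only: sum.delta)
    also have "\<dots> = ?g"
      using assms(1,2) p by (auto simp: EE_def)
    finally show ?thesis .
  qed
  have scalar: "1 + (qh - inverse qh) * ((-1) ^ p c * qh powi (-1) ^ p c)
      = (if p c = 0 then q else inverse q)"
    using p by (auto simp: q_def power2_eq_square field_simps)
  show ?thesis
  proof (cases "c = d")
    case True
    show ?thesis
      unfolding Rbraces_def diag off w using True scalar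
      by (simp flip: single_add)
  next
    case False
    thus ?thesis
      unfolding Rbraces_def diag off w by (simp add: mult_ac)
  qed
qed

text \<open>For \<open>c < d\<close> the term \<open>(z - 1)(q - q\<^sup>-\<^sup>1)\<tau>\<close> from the braces and the last term
  \<open>(q - q\<^sup>-\<^sup>1)\<tau>\<close> of \<open>R(z)\<close> add up to \<open>z(q - q\<^sup>-\<^sup>1)\<tau>\<close>, and \<open>\<tau>\<^sup>2 = 1\<close>.  This is the source of the factor \<open>z\<^bsup>[c < d]\<^esup>\<close>, which appears
  as the shift by \<open>of_bool (c < d)\<close>.\<close>

lemma Rhat_sgl:
  assumes "c \<in> {1..N}" "d \<in> {1..N}" "\<forall>i\<in>{1..N}. p i \<in> {0, 1}"
  shows "Rhat N p (sgl (c, d, k, l) x) =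
    (if c = d then
       sgl (c, c, k + 1, l - 1) (if p c = 0 then x * q else - x * inverse q)
       + sgl (c, c, k, l) (if p c = 0 then - x * inverse q else x * q)
     else
       sgl (d, c, k + 1, l - 1) (x * (-1) ^ (p c * p d)) - sgl (d, c, k, l) (x * (-1) ^ (p c * p d))
       + sgl (c, d, k + of_bool (c < d), l - of_bool (c < d)) (x * (q - inverse q)))"
proof -
  have p: "p c = 0 \<or> p c = 1" "p d = 0 \<or> p d = 1" using assms by auto
  have "Rhat N p (sgl (c, d, k, l) x) = smul x (Rhat N p (sgl (c, d, k, l) 1))"
    by (simp flip: klinear_smul[OF klinear_Rhat])
  also have "Rhat N p (sgl (c, d, k, l) 1)
    = tau p (mult_z (Rbraces N p (sgl (c, d, k, l) 1))) - tau p (Rbraces N p (sgl (c, d, k, l) 1))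
      + smul (q - inverse q) (tau p (tau p (sgl (c, d, k, l) 1)))"
    by (simp add: Rhat_def Rmat_def klinear_add klinear_smul module_hom.diff[OF klinear_tau]
        mult.assoc)
  finally have eq: "Rhat N p (sgl (c, d, k, l) x) = smul x
     (tau p (mult_z (Rbraces N p (sgl (c, d, k, l) 1))) - tau p (Rbraces N p (sgl (c, d, k, l) 1))
      + smul (q - inverse q) (tau p (tau p (sgl (c, d, k, l) 1))))" .
  show ?thesis
  proof (cases "c = d")
    case True
    thus ?thesis
      unfolding eq Rbraces_sgl[OF assms] using p(2)
      by (auto simp: smul_add smul_diff algebra_simps simp flip: single_add single_diff)
  next
    case False
    thus ?thesis
      unfolding eq Rbraces_sgl[OF assms] using p
      by (auto simp: klinear_add[OF klinear_mult_z] klinear_add[OF klinear_tau] smul_add smul_diff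
          mult_ac)
  qed
qed


section \<open>Operators that commute with the R-matrix\<close>

text \<open>The shape shared by the actions of the \<open>e\<^sub>i\<close> and \<open>f\<^sub>i\<close>: the operator
  \<open>q\<^sup>h\<^sup>/\<^sup>2 \<otimes> E + E \<otimes> q\<^sup>-\<^sup>h\<^sup>/\<^sup>2\<close>, where \<open>E\<close> is \<open>\<alpha> E\<^sub>t\<^sub>s\<close> times the \<open>r\<close>-th power of the spectral
  parameter of the tensor factor.  The weight of \<open>E\<close> under \<open>h\<close> has the sign \<open>\<eta>\<close>, which is 1 for the
  \<open>e\<^sub>i\<close> and -1 for the \<open>f\<^sub>i\<close>.  The exponents are given as \<open>r 0\<close> for \<open>V(u) \<otimes> V(v)\<close>, where the
  first factor carries \<open>u\<close>, and as \<open>0 r\<close> for \<open>V(v) \<otimes> V(u)\<close>.\<close>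

definition root_op ::
  "(nat \<Rightarrow> nat) \<Rightarrow> int \<Rightarrow> nat \<Rightarrow> nat \<Rightarrow> Kq \<Rightarrow> int \<Rightarrow> int \<Rightarrow> (evb2 \<Rightarrow>\<^sub>0 Kq) \<Rightarrow> evb2 \<Rightarrow>\<^sub>0 Kq" where
  "root_op p \<eta> s t \<alpha> r r' = lin_ext (\<lambda>(c, d, k, l).
     (if c = s then sgl (t, d, k + r, l + r')
        (\<alpha> * qh powi (- (\<eta> * ((-1) ^ p t * of_bool (d = t) - (-1) ^ p s * of_bool (d = s))))) else 0)
   + (if d = s then sgl (c, t, k + r', l + r)
        ((-1) ^ ((p s + p t) * p c) * \<alpha>
          * qh powi (\<eta> * ((-1) ^ p t * of_bool (c = t) - (-1) ^ p s * of_bool (c = s)))) else 0))"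

lemma klinear_root_op [simp]: "klinear (root_op p \<eta> s t \<alpha> r r')"
  by (simp add: root_op_def)

lemma root_op_sgl:
  "root_op p \<eta> s t \<alpha> r r' (sgl (c, d, k, l) x) =
     (if c = s then sgl (t, d, k + r, l + r')
        (x * \<alpha> * qh powi (- (\<eta> * ((-1) ^ p t * of_bool (d = t) - (-1) ^ p s * of_bool (d = s))))) else 0)
   + (if d = s then sgl (c, t, k + r', l + r)
        (x * (-1) ^ ((p s + p t) * p c) * \<alpha>
          * qh powi (\<eta> * ((-1) ^ p t * of_bool (c = t) - (-1) ^ p s * of_bool (c = s)))) else 0)"
  by (simp add: root_op_def smul_add mult_ac)

text \<open>The heart of the proof.  The hypotheses \<open>right\<close> and \<open>left\<close> say that the powers of \<open>u\<close> and \<open>v\<close>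
  agree on vectors with just one index \<open>s\<close>: for \<open>v\<^sub>c \<otimes> v\<^sub>s\<close>, for instance, the coefficients of
  \<open>v\<^sub>c \<otimes> v\<^sub>t\<close> on the two sides are \<open>v\<^sup>r z\<^bsup>[c < t]\<^esup>\<close> and \<open>u\<^sup>r z\<^bsup>[c < s]\<^esup>\<close>, up to a common factor.
  On vectors with both indices in \<open>{s, t}\<close> the factors \<open>q\<^sup>\<plusminus>\<^sup>h\<^sup>/\<^sup>2\<close> matter, and the
  condition \<open>r\<close> on the exponent depends on the sign \<open>\<eta>\<close>.\<close>

lemma Rhat_root_op:
  assumes "\<forall>i\<in>{1..N}. p i \<in> {0, 1}" "s \<in> {1..N}" "t \<in> {1..N}" "s \<noteq> t" "\<eta> \<in> {1, -1}"
    and r: "(of_bool (t < s) :: int) = of_bool (\<eta> = 1) - r"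
    and right: "\<And>c. c \<in> {1..N} \<Longrightarrow> c \<noteq> s \<Longrightarrow> c \<noteq> t \<Longrightarrow> (of_bool (c < t) :: int) = of_bool (c < s) + r"
    and left: "\<And>c. c \<in> {1..N} \<Longrightarrow> c \<noteq> s \<Longrightarrow> c \<noteq> t \<Longrightarrow> (of_bool (s < c) :: int) = of_bool (t < c) + r"
    and cd: "c \<in> {1..N}" "d \<in> {1..N}"
  shows "Rhat N p (root_op p \<eta> s t \<alpha> r 0 (sgl (c, d, k, l) 1))
       = root_op p \<eta> s t \<alpha> 0 r (Rhat N p (sgl (c, d, k, l) 1))"
proof -
  have p: "p c = 0 \<or> p c = 1" "p d = 0 \<or> p d = 1" "p s = 0 \<or> p s = 1" "p t = 0 \<or> p t = 1"
    using assms by auto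
  note R = Rhat_sgl[OF assms(2,2,1)] Rhat_sgl[OF assms(2,3,1)]
    Rhat_sgl[OF assms(3,2,1)] Rhat_sgl[OF assms(3,3,1)]
    Rhat_sgl[OF assms(2) cd(1) assms(1)] Rhat_sgl[OF assms(2) cd(2) assms(1)]
    Rhat_sgl[OF assms(3) cd(1) assms(1)] Rhat_sgl[OF assms(3) cd(2) assms(1)]
    Rhat_sgl[OF cd(1) assms(2) assms(1)] Rhat_sgl[OF cd(2) assms(2) assms(1)]
    Rhat_sgl[OF cd(1) assms(3) assms(1)] Rhat_sgl[OF cd(2) assms(3) assms(1)] Rhat_sgl[OF cd assms(1)]
  note simps = klinear_add[OF klinear_Rhat] klinear_add[OF klinear_root_op]
    module_hom.diff[OF klinear_root_op] root_op_sgl R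
  \<comment> \<open>Keeping the indicators \<open>\<Delta> v u\<close> of \<open>v = u\<close> opaque turns each comparison of coefficients into
    an identity of rational functions, without a case distinction on the basis vectors.\<close>
  obtain \<Delta> :: "evb2 \<Rightarrow> evb2 \<Rightarrow> Kq" where \<Delta>: "lookup (sgl v x) u = x * \<Delta> v u" for v u x
    using that[of "\<lambda>v u. of_bool (v = u)"] by (simp add: lookup_single when_def)
  note eq = lookup_add lookup_minus \<Delta>
  \<comment> \<open>The four alternatives are \<open>e\<^sub>i\<close>, \<open>f\<^sub>0\<close>, \<open>e\<^sub>0\<close> and \<open>f\<^sub>i\<close>, where \<open>0 < i\<close>.\<close>
  have st: "t < s \<and> \<eta> = 1 \<and> r = 0 \<or> t < s \<and> \<eta> = -1 \<and> r = -1
      \<or> s < t \<and> \<eta> = 1 \<and> r = 1 \<or> s < t \<and> \<eta> = -1 \<and> r = 0"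
    using assms(4,5) r by (cases "t < s") auto
  have other: "x < s \<and> x < t \<and> r = 0 \<or> s < x \<and> t < x \<and> r = 0
      \<or> s < x \<and> x < t \<and> r = 1 \<or> t < x \<and> x < s \<and> r = -1"
    if "x \<in> {1..N}" "x \<noteq> s" "x \<noteq> t" for x
    using right[OF that] left[OF that] that(2,3) by (cases "x < s"; cases "x < t") auto
  consider "c = s" "d = s" | "c = s" "d = t" | "c = t" "d = s" | "c = s" "d \<noteq> s" "d \<noteq> t"
    | "c \<noteq> s" "c \<noteq> t" "d = s" | "c \<noteq> s" "d \<noteq> s" by blast
  thus ?thesis
  proof cases
    case 1
    thus ?thesis using st p(3,4) assms(4) unfolding simps
      by (elim disjE conjE)
        (simp_all add: simps, (rule poly_mapping_eqI; simp only: eq;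
          simp add: q_def power_int_minus power2_eq_square field_simps)+)
  next
    case 2
    thus ?thesis using st p(3,4) assms(4) unfolding simps
      by (elim disjE conjE)
        (simp_all add: simps, (rule poly_mapping_eqI; simp only: eq;
          simp add: q_def power_int_minus power2_eq_square field_simps)+)
  next
    case 3
    thus ?thesis using st p(3,4) assms(4) unfolding simps
      by (elim disjE conjE)
        (simp_all add: simps, (rule poly_mapping_eqI; simp only: eq;
          simp add: q_def power_int_minus power2_eq_square field_simps)+)
  next
    \<comment> \<open>From here on \<open>\<eta>\<close> drops out, as \<open>h\<close> annihilates the basis vectors other than \<open>v\<^sub>s\<close> and \<open>v\<^sub>t\<close>.\<close>
    case 4
    thus ?thesis using p(2-4) assms(4) other[OF cd(2) 4(2,3)] unfolding simps
      by (elim disjE conjE)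
        (simp_all add: simps, (rule poly_mapping_eqI; simp only: eq;
          simp add: q_def power_int_minus power2_eq_square field_simps)+)
  next
    case 5
    thus ?thesis using p(1,3,4) assms(4) other[OF cd(1) 5(1,2)] unfolding simps
      by (elim disjE conjE)
        (simp_all add: simps, (rule poly_mapping_eqI; simp only: eq;
          simp add: q_def power_int_minus power2_eq_square field_simps)+)
  next
    case 6
    thus ?thesis by (simp add: simps)
  qed
qed

lemma Rhat_diagonal:
  assumes "\<forall>i\<in>{1..N}. p i \<in> {0, 1}" "c \<in> {1..N}" "d \<in> {1..N}" "klinear T"
    and T: "\<And>c d k l. T (sgl (c, d, k, l) 1) = smul (\<phi> c d (k + l)) (sgl (c, d, k, l) 1)"
    and sym: "\<And>c d n. \<phi> c d n = \<phi> d c n"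
  shows "Rhat N p (T (sgl (c, d, k, l) 1)) = T (Rhat N p (sgl (c, d, k, l) 1))"
proof -
  have T': "T (sgl (c, d, k, l) x) = smul (\<phi> c d (k + l)) (sgl (c, d, k, l) x)" for c d k l x
    using klinear_smul[OF assms(4), of x "sgl (c, d, k, l) 1"] T[of c d k l] by (simp add: mult.commute)
  have eq: "T (Rhat N p (sgl (c, d, k, l) 1)) = smul (\<phi> c d (k + l)) (Rhat N p (sgl (c, d, k, l) 1))"
    unfolding Rhat_sgl[OF assms(2,3,1)]
    by (cases "c = d") (simp_all add: T' klinear_add[OF assms(4)] module_hom.diff[OF assms(4)]
        smul_add smul_diff sym[of d c])
  show ?thesis
    unfolding eq T klinear_smul[OF klinear_Rhat] ..
qed

section \<open>The generators\<close>

lemma swap_root_op: "swap_uv (root_op p \<eta> s t \<alpha> r r' (swap_uv w)) = root_op p \<eta> s t \<alpha> r' r w"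
proof (rule klinear_eqI[of "\<lambda>w. swap_uv (root_op p \<eta> s t \<alpha> r r' (swap_uv w))"])
  show "klinear (\<lambda>w. swap_uv (root_op p \<eta> s t \<alpha> r r' (swap_uv w)))"
    by (intro klinear_comp[OF klinear_swap_uv] klinear_comp[OF klinear_root_op] klinear_swap_uv)
  fix v :: evb2
  show "swap_uv (root_op p \<eta> s t \<alpha> r r' (swap_uv (sgl v 1))) = root_op p \<eta> s t \<alpha> r' r (sgl v 1)"
    by (cases v) (simp add: root_op_sgl klinear_add[OF klinear_swap_uv])
qed simp

lemma neg_one_power_mod:
  "(-1) ^ (n mod 2 * m) = ((-1) ^ (n * m) :: 'a :: ring_1)"
  "(-1) ^ (m * (n mod 2)) = ((-1) ^ (m * n) :: 'a :: ring_1)"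
  by (rule neg_one_power_cong, auto simp: even_add)+

lemma op_uv_E:
  assumes "N > 2"
  shows "op_uv N p a b (coprod_gen (gE i)) w = (if i = 0 then root_op p 1 1 N (of_C a) 1 0 w
           else root_op p 1 (i + 1) i 1 0 0 w)"
proof -
  let ?T = "if i = 0 then root_op p 1 1 N (of_C a) 1 0 else root_op p 1 (i + 1) i 1 0 0"
  have "op_uv N p a b (coprod_gen (gE i)) w = ?T w"
  proof (rule klinear_eqI[of "op_uv N p a b (coprod_gen (gE i))" ?T])
    fix v :: evb2
    obtain c d k l where v: "v = (c, d, k, l)" by (cases v)
    show "op_uv N p a b (coprod_gen (gE i)) (sgl v 1) = ?T (sgl v 1)"
      using assms
      by (cases "i = 0")
        (simp_all add: v module_hom.add[OF klinear_op_uv_left] op_uv_gg root_op_sgl munit_def rpar_def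
          hval_def neg_one_power_mod mult_ac add_ac)
  qed auto
  thus ?thesis by simp
qed

lemma op_uv_F:
  assumes "N > 2"
  shows "op_uv N p a b (coprod_gen (gF i)) w = (if i = 0 then root_op p (-1) N 1 (of_C b) (-1) 0 w
           else root_op p (-1) i (i + 1) ((-1) ^ p i) 0 0 w)"
proof -
  let ?T = "if i = 0 then root_op p (-1) N 1 (of_C b) (-1) 0
            else root_op p (-1) i (i + 1) ((-1) ^ p i) 0 0"
  have "op_uv N p a b (coprod_gen (gF i)) w = ?T w"
  proof (rule klinear_eqI[of "op_uv N p a b (coprod_gen (gF i))" ?T])
    fix v :: evb2
    obtain c d k l where v: "v = (c, d, k, l)" by (cases v)
    show "op_uv N p a b (coprod_gen (gF i)) (sgl v 1) = ?T (sgl v 1)"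
      using assms
      by (cases "i = 0")
        (simp_all add: v module_hom.add[OF klinear_op_uv_left] op_uv_gg root_op_sgl munit_def rpar_def
          hval_def neg_one_power_mod mult_ac add_ac)
  qed auto
  thus ?thesis by simp
qed

lemma op_vu_E:
  assumes "N > 2"
  shows "op_vu N p a b (coprod_gen (gE i)) w = (if i = 0 then root_op p 1 1 N (of_C a) 0 1 w
           else root_op p 1 (i + 1) i 1 0 0 w)"
  unfolding op_vu_def op_uv_E[OF assms] by (simp only: swap_root_op split: if_split) simp

lemma op_vu_F:
  assumes "N > 2"
  shows "op_vu N p a b (coprod_gen (gF i)) w = (if i = 0 then root_op p (-1) N 1 (of_C b) 0 (-1) w
           else root_op p (-1) i (i + 1) ((-1) ^ p i) 0 0 w)"
  unfolding op_vu_def op_uv_F[OF assms] by (simp only: swap_root_op split: if_split) simp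

lemma intertwines_gen_basis:
  assumes N: "N > 2" and p: "\<forall>i\<in>{1..N}. p i \<in> {0, 1}" and g: "g \<in> gens N"
    and c: "c \<in> {1..N}" and d: "d \<in> {1..N}"
  shows "Rhat N p (op_uv N p a b (coprod_gen g) (sgl (c, d, k, l) 1))
       = op_vu N p a b (coprod_gen g) (Rhat N p (sgl (c, d, k, l) 1))"
proof -
  have diag: ?thesis
    if "\<And>c d k l. op_uv N p a b (coprod_gen g) (sgl (c, d, k, l) 1)
          = smul (\<phi> c d (k + l)) (sgl (c, d, k, l) 1)" "\<And>c d n. \<phi> c d n = \<phi> d c n" for \<phi>
  proof -
    have "op_uv N p a b (coprod_gen g) (sgl (c, d, k, l) 1)
        = op_vu N p a b (coprod_gen g) (sgl (c, d, k, l) 1)"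
      by (simp add: op_vu_def that(1) add.commute)
    thus ?thesis
      using Rhat_diagonal[OF p c d klinear_op_vu, of N p a b "coprod_gen g" \<phi> k l] that
      by (simp add: op_vu_def add.commute)
  qed
  show ?thesis
  proof (cases g)
    case (gE i)
    show ?thesis
    proof (cases "i = 0")
      case True
      thus ?thesis
        unfolding gE op_vu_E[OF N] op_uv_E[OF N] if_P[OF True]
        by (intro Rhat_root_op p c d) (use N in auto)
    next
      case False
      thus ?thesis
        unfolding gE op_vu_E[OF N] op_uv_E[OF N] if_not_P[OF False]
        by (intro Rhat_root_op p c d) (use g gE in \<open>auto simp: gens_def\<close>)
    qed
  next
    case (gF i)
    show ?thesis
    proof (cases "i = 0")
      case True
      thus ?thesis
        unfolding gF op_vu_F[OF N] op_uv_F[OF N] if_P[OF True]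
        by (intro Rhat_root_op p c d) (use N in auto)
    next
      case False
      thus ?thesis
        unfolding gF op_vu_F[OF N] op_uv_F[OF N] if_not_P[OF False]
        by (intro Rhat_root_op p c d) (use g gF in \<open>auto simp: gens_def\<close>)
    qed
  next
    case (gH i)
    thus ?thesis
      by (intro diag[of "\<lambda>c d n. qh powi hval N p i c * qh powi hval N p i d"])
        (simp_all add: op_uv_gg)
  next
    case (gHinv i)
    thus ?thesis
      by (intro diag[of "\<lambda>c d n. qh powi (- hval N p i c) * qh powi (- hval N p i d)"])
        (simp_all add: op_uv_gg)
  next
    case gD
    thus ?thesis
      by (intro diag[of "\<lambda>c d n. q powi n"]) (simp_all add: op_uv_gg power_int_add)
  next
    case gDinv
    thus ?thesis
      by (intro diag[of "\<lambda>c d n. inverse (q powi n)"])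
       (simp_all add: op_uv_gg power_int_minus power_int_add mult_ac)
  qed (intro diag[of "\<lambda>c d n. 1"]; simp add: op_uv_gg)+
qed


section \<open>From generators to all elements\<close>

lemma VV_add: "x \<in> VV N \<Longrightarrow> y \<in> VV N \<Longrightarrow> x + y \<in> VV N"
  using Poly_Mapping.keys_add[of x y] by (auto simp: VV_def)

lemma VV_smul: "x \<in> VV N \<Longrightarrow> smul c x \<in> VV N"
  by (auto simp: VV_def in_keys_iff)

lemma VV_0: "0 \<in> VV N"
  by (simp add: VV_def)

lemma VV_sgl: "i \<in> {1..N} \<Longrightarrow> j \<in> {1..N} \<Longrightarrow> sgl (i, j, k, l) x \<in> VV N"
  by (simp add: VV_def)

lemma VV_sum: "(\<And>b. b \<in> A \<Longrightarrow> f b \<in> VV N) \<Longrightarrow> sum f A \<in> VV N"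
  by (induction A rule: infinite_finite_induct) (simp_all add: VV_0 VV_add)

lemma VV_image:
  assumes "klinear T" "w \<in> VV N"
    and T: "\<And>c d k l. c \<in> {1..N} \<Longrightarrow> d \<in> {1..N} \<Longrightarrow> T (sgl (c, d, k, l) 1) \<in> VV N"
  shows "T w \<in> VV N"
  unfolding klinear_expansion[OF assms(1), of w]
proof (intro VV_sum VV_smul)
  fix v :: evb2 assume v: "v \<in> keys w"
  obtain c d k l where cd: "v = (c, d, k, l)" by (cases v)
  have "c \<in> {1..N}" "d \<in> {1..N}"
    using v assms(2) unfolding cd VV_def by blast+
  thus "T (sgl v 1) \<in> VV N"
    unfolding cd by (rule T)
qed

lemma root_op_VV:
  assumes "t \<in> {1..N}" "w \<in> VV N"
  shows "root_op p \<eta> s t \<alpha> r r' w \<in> VV N"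
  using klinear_root_op assms(2)
  by (rule VV_image) (use assms(1) in \<open>auto simp: root_op_sgl intro!: VV_add VV_sgl VV_0\<close>)

lemma op_uv_gen_VV:
  assumes N: "N > 2" and g: "g \<in> gens N" and w: "w \<in> VV N"
  shows "op_uv N p a b (coprod_gen g) w \<in> VV N"
proof (cases g)
  case (gE i)
  thus ?thesis
    using N g w by (auto simp: op_uv_E gens_def intro!: root_op_VV simp del: coprod_gen.simps)
next
  case (gF i)
  thus ?thesis
    using N g w by (auto simp: op_uv_F gens_def intro!: root_op_VV simp del: coprod_gen.simps)
qed (rule VV_image[OF klinear_op_uv w], simp add: op_uv_gg VV_sgl)+

lemma intertwines_gen:
  assumes "N > 2" "\<forall>i\<in>{1..N}. p i \<in> {0, 1}" "g \<in> gens N" "w \<in> VV N"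
  shows "Rhat N p (op_uv N p a b (coprod_gen g) w) = op_vu N p a b (coprod_gen g) (Rhat N p w)"
proof (rule klinear_eqI[OF klinear_comp[OF klinear_Rhat klinear_op_uv]
      klinear_comp[OF klinear_op_vu klinear_Rhat]])
  fix v :: evb2 assume "v \<in> keys w"
  thus "Rhat N p (op_uv N p a b (coprod_gen g) (sgl v 1))
      = op_vu N p a b (coprod_gen g) (Rhat N p (sgl v 1))"
    using assms(4) by (cases v) (auto simp: VV_def intro!: intertwines_gen_basis assms(1-3))
qed

lemma op_uv_one: "op_uv N p a b (sgl (0, 0) 1) w = w"
  by (rule klinear_eqI[OF klinear_op_uv klinear_ident]) (auto simp: op_uv_def)

lemma op_vu_one: "op_vu N p a b (sgl (0, 0) 1) w = w"
  by (simp add: op_vu_def op_uv_one)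

text \<open>Induction on the word; invariance of the space \<open>VV N\<close> keeps the indices in the range where the
  formula for the R-matrix holds.\<close>

lemma intertwines_word:
  assumes N: "N > 2" and p: "\<forall>i\<in>{1..N}. p i \<in> {0, 1}"
  shows "set (letters x) \<subseteq> gens N \<Longrightarrow> w \<in> VV N \<Longrightarrow>
    Rhat N p (op_uv N p a b (coprod_word N p x) w) = op_vu N p a b (coprod_word N p x) (Rhat N p w)"
proof -
  have *: "op_uv N p a b (coprod_word N p (Wd gs)) w \<in> VV N \<and>
      Rhat N p (op_uv N p a b (coprod_word N p (Wd gs)) w)
      = op_vu N p a b (coprod_word N p (Wd gs)) (Rhat N p w)"
    if "set gs \<subseteq> gens N" "w \<in> VV N" for gs
    using that
  proof (induction gs)
    case Nil
    thus ?case by (simp add: coprod_word_def op_uv_one op_vu_one)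
  next
    case (Cons g gs)
    have "coprod_word N p (Wd (g # gs)) = gmult N p (coprod_gen g) (coprod_word N p (Wd gs))"
      by (simp add: coprod_word_def)
    thus ?case
      using Cons by (simp add: op_uv_gmult op_vu_gmult intertwines_gen[OF N p] op_uv_gen_VV[OF N])
  qed
  assume "set (letters x) \<subseteq> gens N" "w \<in> VV N"
  thus ?thesis using *[of "letters x"] by simp
qed

theorem theoremA18:
  fixes m n N :: nat and p :: "nat \<Rightarrow> nat" and a b :: complex
    and X :: "falg set" and x :: falg and w :: "evb2 \<Rightarrow>\<^sub>0 Kq"
  assumes "N = m + n" and "N > 2"
    and "\<forall>i\<in>{1..N}. p i \<in> {0, 1}"
    and "card {i \<in> {1..N}. p i = 0} = m" and "card {i \<in> {1..N}. p i = 1} = n"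
    and "a \<noteq> 0" and "b \<noteq> 0" and "a * b = (-1) ^ p N"
    and "X \<in> carrier (Uq N p)" and "x \<in> X"
    and "w \<in> VV N"
  shows "Rhat N p (act_uv N p a b x w) = act_vu N p a b x (Rhat N p w)"
proof -
  have x: "x \<in> fcar N"
    using Uq_representative assms(9,10) .
  show ?thesis
    unfolding act_uv_op act_vu_op coprod_def
  proof (rule klinear_eqI[of "\<lambda>x. Rhat N p (op_uv N p a b (lin_ext (coprod_word N p) x) w)"
        "\<lambda>x. op_vu N p a b (lin_ext (coprod_word N p) x) (Rhat N p w)"])
    fix v assume "v \<in> keys x"
    hence "set (letters v) \<subseteq> gens N"
      using x by (simp add: fcar_iff)
    thus "Rhat N p (op_uv N p a b (lin_ext (coprod_word N p) (sgl v 1)) w)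
        = op_vu N p a b (lin_ext (coprod_word N p) (sgl v 1)) (Rhat N p w)"
      using intertwines_word[OF assms(2,3)] assms(11) by simp
  qed (intro klinear_comp[OF klinear_Rhat] klinear_comp[OF klinear_op_uv_left]
      klinear_comp[OF klinear_op_vu_left] klinear_lin_ext)+
qed

end
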